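(* Consider a gyrostat low-order model (GLOM) with a fixed coupling configuration of $K$ gyrostats to $M$ modes. Starting from a GLOM with some of its parameters set to zero, making any subset of those parameters nonzero (all other parameters being unchanged up to the energy constraint $p_k+q_k+r_k=0$, which holds before and after) cannot increase the number of quadratic invariants.
   Context: A gyrostat low-order model (GLOM) with $K\ge 1$ gyrostats and $M\ge 3$ modes is the following system of ODEs for $x=(x_1,\dots,x_M)\in\mathbb{R}^M$. For each $k\in\{1,\dots,K\}$ one is given an ordered triple of distinct mode indices $(m_1^{(k)},m_2^{(k)},m_3^{(k)})$ in $\{1,\dots,M\}$ (the collection of these triples is the coupling configuration) and real parameters $a_k,b_k,c_k,p_k,q_k,r_k$ subject to $p_k+q_k+r_k=0$. With $y_l^{(k)}=x_{m_l^{(k)}}$, gyrostat $k$ contributes $$p_k y_2^{(k)}y_3^{(k)}+b_k y_3^{(k)}-c_k y_2^{(k)}\ \text{ to } \dot x_{m_1^{(k)}},$$ $$q_k y_3^{(k)}y_1^{(k)}+c_k y_1^{(k)}-a_k y_3^{(k)}\ \text{ to } \dot x_{m_2^{(k)}},$$ $$r_k y_1^{(k)}y_2^{(k)}+a_k y_2^{(k)}-b_k y_1^{(k)}\ \text{ to } \dot x_{m_3^{(k)}},$$ and $\dot x_i$ is the sum of all contributions to it. A quadratic invariant is a polynomial $$C(x)=\tfrac12\sum_i d_i x_i^2+\sum_{i<j}e_{ij}x_ix_j+\sum_i f_i x_i$$ with real coefficients such that $\dot C=\sum_i \frac{\partial C}{\partial x_i}\dot x_i$ vanishes identically in $x$.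 Collecting linearly independent monomials in $\dot C=0$ gives a homogeneous linear system $\mathrm{A}u=0$ for the vector $u$ of coefficients $(d_i,e_{ij},f_i)$. The number of quadratic invariants is $\dim \mathrm{NULL}(\mathrm{A})$, i.e. the dimension of the real vector space of such polynomials $C$.
   Formalization: The claim is proved for generic nonzero values of the new (and compensating) parameters, off a nowhere dense algebraic set. For all values it is false: with triples (1,2,3), (1,2,4), c_1=1, all else zero, making c_2=-1 raises the number of invariants from 6 to 14. *)

theory Defs
  imports "HOL-Analysis.Analysis"
begin

text \<open>The parameters of a single gyrostat: \<open>GA, GB, GC\<close> stand for the linear feedback parameters
  $a, b, c$ and \<open>GP, GQ, GR\<close> for the coefficients $p, q, r$ of the nonlinear terms.\<close>

datatype gparam = GA | GB | GC | GP | GQ | GR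

instance gparam :: finite
proof
  have "(UNIV :: gparam set) = {GA, GB, GC, GP, GQ, GR}"
    by (auto intro: gparam.exhaust)
  then show "finite (UNIV :: gparam set)"
    by (metis finite.emptyI finite_insert)
qed

text \<open>A model with \<open>CARD('k)\<close> gyrostats and \<open>CARD('m)\<close> modes has the coupling configuration
  \<open>m :: 'k \<Rightarrow> 3 \<Rightarrow> 'm\<close>, where \<open>m k l\<close> is the $l$-th mode of gyrostat $k$, and the parameter vector
  \<open>\<theta> :: real^gparam^'k\<close>.\<close>

definition gyrostat :: "real^gparam \<Rightarrow> real^3 \<Rightarrow> real^3" where
  "gyrostat g y = vector
     [g $ GP * y $ 2 * y $ 3 + g $ GB * y $ 3 - g $ GC * y $ 2,
      g $ GQ * y $ 3 * y $ 1 + g $ GC * y $ 1 - g $ GA * y $ 3,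
      g $ GR * y $ 1 * y $ 2 + g $ GA * y $ 2 - g $ GB * y $ 1]"

definition glom_field :: "('k::finite \<Rightarrow> 3 \<Rightarrow> 'm::finite) \<Rightarrow> real^gparam^'k \<Rightarrow> real^'m \<Rightarrow> real^'m" where
  "glom_field m \<theta> x =
     (\<chi> i. \<Sum>k\<in>UNIV. \<Sum>l\<in>{l. m k l = i}. gyrostat (\<theta> $ k) (\<chi> l. x $ m k l) $ l)"

definition energy_constraint :: "real^gparam^'k::finite \<Rightarrow> bool" where
  "energy_constraint \<theta> \<longleftrightarrow> (\<forall>k. \<theta> $ k $ GP + \<theta> $ k $ GQ + \<theta> $ k $ GR = 0)"

text \<open>A polynomial $C$ is represented by its coefficients \<open>(d, e, f)\<close>. Only the entries
  \<open>e $ i $ j\<close> with \<open>i < j\<close> are coefficients; the others are required to vanish.\<close>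

type_synonym 'm coeffs = "(real^'m) \<times> (real^'m^'m) \<times> (real^'m)"

definition coeff_space :: "'m::{finite,linorder} coeffs set" where
  "coeff_space = {(d, e, f). \<forall>i j. \<not> i < j \<longrightarrow> e $ i $ j = 0}"

definition quad_poly :: "'m coeffs \<Rightarrow> real^'m::{finite,linorder} \<Rightarrow> real" where
  "quad_poly u x = (case u of (d, e, f) \<Rightarrow>
     1/2 * (\<Sum>i\<in>UNIV. d $ i * (x $ i)\<^sup>2) +
     (\<Sum>i\<in>UNIV. \<Sum>j\<in>{i<..}. e $ i $ j * x $ i * x $ j) +
     (\<Sum>i\<in>UNIV. f $ i * x $ i))"

definition time_derivative :: "(real^'m \<Rightarrow> real) \<Rightarrow> (real^'m \<Rightarrow> real^'m) \<Rightarrow> real^'m::finite \<Rightarrow> real" where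
  "time_derivative C V x = (\<Sum>i\<in>UNIV. frechet_derivative C (at x) (axis i 1) * V x $ i)"

definition quadratic_invariants ::
  "('k::finite \<Rightarrow> 3 \<Rightarrow> 'm::{finite,linorder}) \<Rightarrow> real^gparam^'k \<Rightarrow> 'm coeffs set" where
  "quadratic_invariants m \<theta> =
     {u \<in> coeff_space. \<forall>x. time_derivative (quad_poly u) (glom_field m \<theta>) x = 0}"

definition num_quadratic_invariants ::
  "('k::finite \<Rightarrow> 3 \<Rightarrow> 'm::{finite,linorder}) \<Rightarrow> real^gparam^'k \<Rightarrow> nat" where
  "num_quadratic_invariants m \<theta> = dim (quadratic_invariants m \<theta>)"

definition zero_params :: "real^gparam^'k::finite \<Rightarrow> ('k \<times> gparam) set" where
  "zero_params \<theta> = {(k, s). \<theta> $ k $ s = 0}"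

text \<open>If one of $p_k, q_k, r_k$ is switched on, then others of the same gyrostat may have to be
  changed to restore $p_k + q_k + r_k = 0$. These are the nonzero parameters eligible for
  such a compensation when the parameters in \<open>S\<close> are switched on; no others may change.\<close>

definition compensators :: "real^gparam^'k::finite \<Rightarrow> ('k \<times> gparam) set \<Rightarrow> ('k \<times> gparam) set" where
  "compensators \<theta> S =
     {(k, s). s \<in> {GP, GQ, GR} \<and> \<theta> $ k $ s \<noteq> 0 \<and> (\<exists>s'\<in>{GP, GQ, GR}. (k, s') \<in> S)}"

text \<open>All parameter vectors obtained from \<open>\<theta>\<close> by making the parameters in \<open>S\<close> nonzero and
  adjusting those in \<open>T\<close> as compensation. It is empty if \<open>T\<close> leaves no room to restore the
  energy constraint.\<close>

definition switched_on ::
  "real^gparam^'k::finite \<Rightarrow> ('k \<times> gparam) set \<Rightarrow> ('k \<times> gparam) set \<Rightarrow> (real^gparam^'k) set" where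
  "switched_on \<theta> S T =
     {\<theta>'. energy_constraint \<theta>' \<and>
          (\<forall>k s. (k, s) \<in> S \<union> T \<longrightarrow> \<theta>' $ k $ s \<noteq> 0) \<and>
          (\<forall>k s. (k, s) \<notin> S \<union> T \<longrightarrow> \<theta>' $ k $ s = \<theta> $ k $ s)}"

text \<open>\<open>P\<close> holds generically on \<open>F\<close>: at all points of \<open>F\<close> off the zero set of a polynomial,
  this zero set being nowhere dense in \<open>F\<close>.\<close>

definition generically_on :: "'a::real_normed_vector set \<Rightarrow> ('a \<Rightarrow> bool) \<Rightarrow> bool" where
  "generically_on F P \<longleftrightarrow>
     (\<exists>g. real_polynomial_function g \<and> F \<subseteq> closure {x \<in> F. g x \<noteq> 0} \<and>
          (\<forall>x\<in>F. g x \<noteq> 0 \<longrightarrow> P x))"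

text \<open>Genericity is indispensable. Two gyrostats sharing two modes, with $c_1 = 1$ and all other
  parameters zero: the special choice $c_2 = -1$ cancels the flow, so that every polynomial
  becomes an invariant.\<close>

definition cex_config :: "2 \<Rightarrow> 3 \<Rightarrow> 4" where
  "cex_config k l = (if l = 1 then 1 else if l = 2 then 2 else if k = 1 then 3 else 4)"

definition cex_params :: "real \<Rightarrow> real^gparam^2" where
  "cex_params c = (\<chi> k s. if s = GC then (if k = 1 then 1 else c) else 0)"

lemma frechet_derivative_quad_poly:
  "frechet_derivative (quad_poly (d, e, f)) (at x) =
     (\<lambda>h. (\<Sum>i\<in>UNIV. d $ i * x $ i * h $ i) +
          (\<Sum>i\<in>UNIV. \<Sum>j\<in>{i<..}. e $ i $ j * (x $ i * h $ j + h $ i * x $ j)) +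
          (\<Sum>i\<in>UNIV. f $ i * h $ i))"
proof -
  have nth: "((\<lambda>y. y $ i) has_derivative (\<lambda>h. h $ i)) (at x)" for i :: 'a
    by (intro bounded_linear_imp_has_derivative bounded_linear_vec_nth)
  have "((\<lambda>y. d $ i * (y $ i)\<^sup>2) has_derivative (\<lambda>h. 2 * (d $ i * x $ i * h $ i))) (at x)" for i
    using has_derivative_mult_right[OF has_derivative_power[OF nth, where n = 2]]
    by (rule has_derivative_eq_rhs) (simp add: fun_eq_iff)
  then have D: "((\<lambda>y. 1/2 * (\<Sum>i\<in>UNIV. d $ i * (y $ i)\<^sup>2)) has_derivative
      (\<lambda>h. 1/2 * (\<Sum>i\<in>UNIV. 2 * (d $ i * x $ i * h $ i)))) (at x)"
    by (intro has_derivative_mult_right has_derivative_sum)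
  have "((\<lambda>y. e $ i $ j * y $ i * y $ j) has_derivative
      (\<lambda>h. e $ i $ j * (x $ i * h $ j + h $ i * x $ j))) (at x)" for i j
    using has_derivative_mult_right[OF has_derivative_mult[OF nth nth]]
    unfolding mult.assoc .
  then have E: "((\<lambda>y. \<Sum>i\<in>UNIV. \<Sum>j\<in>{i<..}. e $ i $ j * y $ i * y $ j) has_derivative
      (\<lambda>h. \<Sum>i\<in>UNIV. \<Sum>j\<in>{i<..}. e $ i $ j * (x $ i * h $ j + h $ i * x $ j))) (at x)"
    by (intro has_derivative_sum)
  have F: "((\<lambda>y. \<Sum>i\<in>UNIV. f $ i * y $ i) has_derivative (\<lambda>h. \<Sum>i\<in>UNIV. f $ i * h $ i)) (at x)"
    by (intro has_derivative_sum has_derivative_mult_right nth)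
  have "1/2 * (\<Sum>i\<in>UNIV. 2 * (d $ i * x $ i * h $ i)) = (\<Sum>i\<in>UNIV. d $ i * x $ i * h $ i)" for h
    by (simp add: sum_distrib_left[symmetric])
  with has_derivative_add[OF has_derivative_add[OF D E] F]
  have "(quad_poly (d, e, f) has_derivative
     (\<lambda>h. (\<Sum>i\<in>UNIV. d $ i * x $ i * h $ i) +
          (\<Sum>i\<in>UNIV. \<Sum>j\<in>{i<..}. e $ i $ j * (x $ i * h $ j + h $ i * x $ j)) +
          (\<Sum>i\<in>UNIV. f $ i * h $ i))) (at x)"
    unfolding quad_poly_def prod.case by (simp only:)
  then show ?thesis
    by (rule frechet_derivative_at[symmetric])
qed

lemma special_values_can_increase_num_invariants:
  shows "\<forall>k. inj (cex_config k)"
    and "energy_constraint (cex_params 0)"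
    and "cex_params (- 1) \<in> switched_on (cex_params 0) {(2, GC)} {}"
    and "num_quadratic_invariants cex_config (cex_params 0)
           < num_quadratic_invariants cex_config (cex_params (- 1))"
proof -
  show "\<forall>k. inj (cex_config k)"
    by (auto simp: cex_config_def inj_def forall_3)
  show "energy_constraint (cex_params 0)"
    by (simp add: energy_constraint_def cex_params_def)
  show "cex_params (- 1) \<in> switched_on (cex_params 0) {(2, GC)} {}"
    by (auto simp: switched_on_def energy_constraint_def cex_params_def forall_2)
  have field: "glom_field cex_config (cex_params c) x $ i =
      (if i = 1 then - (1 + c) * x $ 2 else if i = 2 then (1 + c) * x $ 1 else 0)" for c x i
  proof -
    have set2: "(\<Sum>l\<in>{l. cex_config k l = i}. h l) = (\<Sum>l\<in>UNIV. if cex_config k l = i then h l else 0)"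
      for k i and h :: "3 \<Rightarrow> real"
      by (simp add: sum.If_cases)
    show ?thesis
      using exhaust_4[of i]
      unfolding glom_field_def set2 sum_2 sum_3
      by (auto simp: cex_config_def gyrostat_def cex_params_def
          algebra_simps)
  qed
  let ?W = "{u :: 4 coeffs. snd (snd u) $ 1 = 0}"
  have "quadratic_invariants cex_config (cex_params (- 1)) = coeff_space"
    by (auto simp: quadratic_invariants_def time_derivative_def field intro!: sum.neutral)
  moreover have "quadratic_invariants cex_config (cex_params 0) \<subseteq> coeff_space \<inter> ?W"
  proof (clarsimp simp: quadratic_invariants_def)
    fix d :: "real^4" and e :: "real^4^4" and f :: "real^4"
    assume inv: "\<forall>x. time_derivative (quad_poly (d, e, f)) (glom_field cex_config (cex_params 0)) x = 0"
    define K where "K = (\<Sum>i\<in>UNIV. \<Sum>j\<in>{i<..}. e $ i $ j *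
      (axis 2 1 $ i * axis 1 1 $ j + axis 1 1 $ i * axis (2::4) (1::real) $ j))"
    have *: "time_derivative (quad_poly (d, e, f)) (glom_field cex_config (cex_params 0)) (axis 2 t)
        = - t * (t * K + f $ 1)" for t
    proof -
      have ax: "axis 2 t = t *\<^sub>R (axis 2 1 :: real^4)"
        by (simp add: vec_eq_iff axis_def)
      have d0: "(\<Sum>i\<in>UNIV. d $ i * axis 2 t $ i * axis 1 1 $ i) = 0"
        by (rule sum.neutral) (auto simp: axis_def)
      have e0: "(\<Sum>i\<in>UNIV. \<Sum>j\<in>{i<..}. e $ i $ j *
          (axis 2 t $ i * axis 1 1 $ j + axis 1 1 $ i * axis (2::4) t $ j)) = t * K"
        unfolding K_def ax by (simp add: sum_distrib_left algebra_simps)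
      have f0: "(\<Sum>i\<in>UNIV. f $ i * axis 1 1 $ i) = f $ 1"
        by (simp add: axis_def if_distrib cong: if_cong)
      have "frechet_derivative (quad_poly (d, e, f)) (at (axis 2 t)) (axis 1 1) = t * K + f $ 1"
        unfolding frechet_derivative_quad_poly d0 e0 f0 by simp
      then show ?thesis
        by (simp add: time_derivative_def field sum_4) (simp add: axis_def)
    qed
    show "f $ 1 = 0"
      using *[of 1] *[of "- 1"] inv by auto
  qed
  then have "dim (quadratic_invariants cex_config (cex_params 0)) \<le> dim (coeff_space \<inter> ?W)"
    by (rule dim_subset)
  moreover have "dim (coeff_space \<inter> ?W) < dim (coeff_space :: 4 coeffs set)"
  proof (rule dim_psubset)
    have cs: "subspace (coeff_space :: 4 coeffs set)"
      by (auto simp: subspace_def coeff_space_def zero_prod_def)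
    have W: "subspace ?W"
      by (auto simp: subspace_def)
    have "(0, 0, axis 1 1) \<in> coeff_space - ?W"
      by (auto simp: coeff_space_def axis_def)
    then have "coeff_space \<inter> ?W \<subset> coeff_space"
      by blast
    then show "span (coeff_space \<inter> ?W) \<subset> span coeff_space"
      using cs W by (metis span_eq_iff subspace_inter)
  qed
  ultimately show "num_quadratic_invariants cex_config (cex_params 0)
           < num_quadratic_invariants cex_config (cex_params (- 1))"
    by (simp add: num_quadratic_invariants_def)
qed

end

theory Submission
  imports Defs
begin

text \<open>For fixed \<open>x\<close>, the condition $\dot C(x) = 0$ is linear in the coefficients of $C$, and its own
  coefficients are polynomials in the parameters. Gaussian elimination with pivots that do not
  vanish at \<open>\<theta>\<close> shows that the rank of this linear system at \<open>\<theta>'\<close> is at least its rank at \<open>\<theta>\<close> unless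
  \<open>\<theta>'\<close> is a zero of a certain polynomial \<open>g\<close> with \<open>g \<theta> \<noteq> 0\<close>. The segment from \<open>\<theta>\<close> to a switched-on
  \<open>\<theta>'\<close> satisfies the energy constraint and leaves the other parameters unchanged, and \<open>g\<close> has only
  finitely many zeros on its line, so that \<open>\<theta>'\<close> is a limit of switched-on points with \<open>g \<noteq> 0\<close>.\<close>

section \<open>Linear algebra with polynomial entries: rank and solution spaces\<close>

text \<open>An indexed family rather than a set: vectors depending on parameters may coincide at
  some parameter values, and the family then counts as dependent, whereas its set of values would
  merely shrink.\<close>

definition independent_family :: "'i set \<Rightarrow> ('i \<Rightarrow> 'v::real_vector) \<Rightarrow> bool" where
  "independent_family I v \<longleftrightarrow> (\<forall>c. (\<Sum>i\<in>I. c i *\<^sub>R v i) = 0 \<longrightarrow> (\<forall>i\<in>I. c i = 0))"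

text \<open>One step of Gaussian elimination: the new vectors have no component along
  \<open>w\<close>. Multiplying by the pivot instead of dividing by it keeps polynomial entries
  polynomial.\<close>

lemma independent_family_eliminate:
  fixes v :: "'i \<Rightarrow> 'v::real_inner"
  assumes "finite I" "a \<notin> I" and pivot: "v a \<bullet> w \<noteq> 0"
  shows "independent_family (insert a I) v \<longleftrightarrow>
    independent_family I (\<lambda>i. (v a \<bullet> w) *\<^sub>R v i - (v i \<bullet> w) *\<^sub>R v a)"
    (is "?L \<longleftrightarrow> independent_family I ?v'")
proof
  have eliminate: "(\<Sum>i\<in>I. c i *\<^sub>R ?v' i) =
      (v a \<bullet> w) *\<^sub>R (\<Sum>i\<in>I. c i *\<^sub>R v i) - (\<Sum>i\<in>I. c i * (v i \<bullet> w)) *\<^sub>R v a" for c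
    by (simp add: scaleR_right_diff_distrib sum_subtractf scaleR_sum_right scaleR_sum_left
        mult.commute)
  show "independent_family I ?v'" if L: ?L
    unfolding independent_family_def
  proof (intro allI impI ballI)
    fix c i
    assume 0: "(\<Sum>i\<in>I. c i *\<^sub>R ?v' i) = 0" and i: "i \<in> I"
    \<comment> \<open>By \<open>eliminate\<close>, a relation among the \<open>?v'\<close> is a
      relation among the \<open>v\<close> with these coefficients.\<close>
    define c' where "c' j = (if j = a then - (\<Sum>i\<in>I. c i * (v i \<bullet> w)) else (v a \<bullet> w) * c j)" for j
    have "(\<Sum>j\<in>I. c' j *\<^sub>R v j) = (v a \<bullet> w) *\<^sub>R (\<Sum>i\<in>I. c i *\<^sub>R v i)"
      unfolding scaleR_sum_right using assms(2) by (intro sum.cong) (auto simp: c'_def)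
    then have "(\<Sum>j\<in>insert a I. c' j *\<^sub>R v j) = 0"
      using 0 assms(1,2) unfolding eliminate by (simp add: c'_def)
    then have "c' i = 0"
      using L i unfolding independent_family_def by blast
    then show "c i = 0"
      using i assms(2) pivot by (auto simp: c'_def split: if_splits)
  qed
  show ?L if R: "independent_family I ?v'"
    unfolding independent_family_def
  proof (intro allI impI)
    fix c
    assume "(\<Sum>i\<in>insert a I. c i *\<^sub>R v i) = 0"
    then have 0: "(\<Sum>i\<in>I. c i *\<^sub>R v i) = - (c a *\<^sub>R v a)"
      using assms(1,2) by (simp add: eq_neg_iff_add_eq_0 add.commute)
    \<comment> \<open>Pairing the relation with \<open>w\<close> yields exactly the coefficient of
      \<open>v a\<close> needed for cancellation in \<open>eliminate\<close>.\<close>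
    have "(\<Sum>i\<in>I. c i * (v i \<bullet> w)) = - (c a * (v a \<bullet> w))"
      using arg_cong[OF 0, of "\<lambda>u. u \<bullet> w"] by (simp add: inner_sum_left)
    then have "(\<Sum>i\<in>I. c i *\<^sub>R ?v' i) = 0"
      unfolding eliminate 0 by (simp add: mult.commute)
    then have I: "\<forall>i\<in>I. c i = 0"
      using R unfolding independent_family_def by blast
    then have "c a *\<^sub>R v a = 0"
      using 0 by simp
    then have "c a = 0"
      using pivot by auto
    with I show "\<forall>i\<in>insert a I. c i = 0"
      by simp
  qed
qed

text \<open>By induction over the elimination steps; \<open>g\<close> is the product of all pivots,
  as polynomials in \<open>p\<close>.\<close>

lemma independent_family_generic:
  fixes f :: "'i \<Rightarrow> 'p::real_normed_vector \<Rightarrow> 'v::euclidean_space"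
  assumes "finite I" "\<forall>i\<in>I. polynomial_function (f i)"
    and "independent_family I (\<lambda>i. f i p\<^sub>0)"
  shows "\<exists>g. real_polynomial_function g \<and> g p\<^sub>0 \<noteq> 0 \<and>
    (\<forall>p. g p \<noteq> 0 \<longrightarrow> independent_family I (\<lambda>i. f i p))"
  using assms
proof (induction I arbitrary: f rule: finite_induct)
  case empty
  then show ?case
    by (intro exI[of _ "\<lambda>_. 1"]) (auto simp: independent_family_def)
next
  case (insert a I)
  \<comment> \<open>\<open>w\<close> does not vary with \<open>p\<close>, so the pivot
    \<open>f a p \<bullet> w\<close> is polynomial in \<open>p\<close>. At \<open>p\<^sub>0\<close>
    it is the squared norm of \<open>w\<close>, which is positive since a member of an independent
    family is nonzero.\<close>
  define w where "w = f a p\<^sub>0"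
  define f' where "f' i p = (f a p \<bullet> w) *\<^sub>R f i p - (f i p \<bullet> w) *\<^sub>R f a p" for i p
  have "w \<noteq> 0"
  proof
    assume "w = 0"
    then have "(\<Sum>i\<in>insert a I. of_bool (i = a) *\<^sub>R f i p\<^sub>0) = 0"
      by (intro sum.neutral) (auto simp: w_def)
    then show False
      using insert.prems(2)[unfolded independent_family_def, rule_format, of "\<lambda>i. of_bool (i = a)" a]
      by simp
  qed
  then have pivot: "f a p\<^sub>0 \<bullet> w \<noteq> 0"
    by (simp add: w_def)
  have eliminate: "independent_family (insert a I) (\<lambda>i. f i p) \<longleftrightarrow> independent_family I (\<lambda>i. f' i p)"
    if "f a p \<bullet> w \<noteq> 0" for p
    unfolding f'_def using insert.hyps that by (rule independent_family_eliminate)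
  have inner: "real_polynomial_function (\<lambda>p. f i p \<bullet> w)" if "i \<in> insert a I" for i
    using insert.prems(1) that by (auto simp: real_polynomial_function_eq)
  have "\<forall>i\<in>I. polynomial_function (f' i)"
    unfolding f'_def using insert.prems(1)
    by (intro ballI polynomial_function_diff polynomial_function_mult
        inner[unfolded real_polynomial_function_eq]) simp_all
  moreover have "independent_family I (\<lambda>i. f' i p\<^sub>0)"
    using insert.prems(2) by (rule iffD1[OF eliminate[OF pivot]])
  ultimately obtain g where g: "real_polynomial_function g" "g p\<^sub>0 \<noteq> 0"
      "\<And>p. g p \<noteq> 0 \<Longrightarrow> independent_family I (\<lambda>i. f' i p)"
    using insert.IH[of f'] by auto
  show ?case
  proof (intro exI conjI)
    show "real_polynomial_function (\<lambda>p. g p * (f a p \<bullet> w))"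
      by (intro real_polynomial_function.intros(4) g(1) inner) simp
  qed (use g pivot eliminate in auto)
qed

text \<open>Two equal members would satisfy a relation with coefficients 1 and -1. Hence the family
  is injective, and its image is an independent set of the same cardinality.\<close>

lemma card_le_dim_if_independent_family:
  fixes v :: "'i \<Rightarrow> 'v::euclidean_space"
  assumes "finite I" "independent_family I v" "v ` I \<subseteq> V"
  shows "card I \<le> dim V"
proof -
  have inj: "inj_on v I"
  proof (rule inj_onI, rule ccontr)
    fix i j
    assume ij: "i \<in> I" "j \<in> I" "v i = v j" "i \<noteq> j"
    have "(\<Sum>k\<in>I. (of_bool (k = i) - of_bool (k = j)) *\<^sub>R v k) = 0"
      using ij assms(1)
      by (simp add: scaleR_left_diff_distrib sum_subtractf of_bool_def if_distrib[of "\<lambda>c. c *\<^sub>R _"]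
          cong: if_cong)
    then show False
      using assms(2)[unfolded independent_family_def, rule_format,
          of "\<lambda>k. of_bool (k = i) - of_bool (k = j)" i] ij
      by simp
  qed
  have "independent (v ` I)"
  proof (rule independent_if_scalars_zero)
    fix c u
    assume 0: "(\<Sum>u\<in>v ` I. c u *\<^sub>R u) = 0" and u: "u \<in> v ` I"
    then have "(\<Sum>i\<in>I. c (v i) *\<^sub>R v i) = 0"
      by (simp add: sum.reindex[OF inj])
    then show "c u = 0"
      using assms(2)[unfolded independent_family_def, rule_format, of "c \<circ> v"] u by auto
  qed (use assms(1) in simp)
  then have "card (v ` I) \<le> dim V"
    by (rule independent_card_le_dim[OF assms(3)])
  then show ?thesis
    by (simp add: card_image[OF inj])
qed

text \<open>Lower semicontinuity of the rank. Even if \<open>\<F>\<close> is infinite, finitely many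
  of its functions have values at \<open>p\<^sub>0\<close> forming a basis of the span there, and
  generically these stay independent.\<close>

lemma dim_generic_ge:
  fixes \<F> :: "('p::real_normed_vector \<Rightarrow> 'v::euclidean_space) set"
  assumes "\<forall>f\<in>\<F>. polynomial_function f"
  shows "\<exists>g. real_polynomial_function g \<and> g p\<^sub>0 \<noteq> 0 \<and>
    (\<forall>p. g p \<noteq> 0 \<longrightarrow> dim ((\<lambda>f. f p\<^sub>0) ` \<F>) \<le> dim ((\<lambda>f. f p) ` \<F>))"
proof -
  obtain B where B: "B \<subseteq> (\<lambda>f. f p\<^sub>0) ` \<F>" "independent B" "card B = dim ((\<lambda>f. f p\<^sub>0) ` \<F>)"
    by (rule basis_exists)
  have fin: "finite B"
    using B(2) by (rule independent_imp_finite)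
  have "\<forall>b\<in>B. \<exists>f. f \<in> \<F> \<and> f p\<^sub>0 = b"
    using B(1) by blast
  then obtain F where F: "\<forall>b\<in>B. F b \<in> \<F> \<and> F b p\<^sub>0 = b"
    using bchoice[of B "\<lambda>b f. f \<in> \<F> \<and> f p\<^sub>0 = b"] by blast
  have "(\<Sum>b\<in>B. c b *\<^sub>R F b p\<^sub>0) = (\<Sum>b\<in>B. c b *\<^sub>R b)" for c
    using F by (intro sum.cong) auto
  then have "independent_family B (\<lambda>b. F b p\<^sub>0)"
    unfolding independent_family_def using B(2) fin by (simp add: independent_explicit)
  then obtain g where g: "real_polynomial_function g" "g p\<^sub>0 \<noteq> 0"
      "\<And>p. g p \<noteq> 0 \<Longrightarrow> independent_family B (\<lambda>b. F b p)"
    using independent_family_generic[OF fin, of F p\<^sub>0] F assms by blast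
  have "dim ((\<lambda>f. f p\<^sub>0) ` \<F>) \<le> dim ((\<lambda>f. f p) ` \<F>)" if "g p \<noteq> 0" for p
    unfolding B(3)[symmetric] using F
    by (intro card_le_dim_if_independent_family[OF fin g(3)[OF that]]) auto
  with g show ?thesis
    by blast
qed

text \<open>Rank-nullity: the solutions form the orthogonal complement of the span of
  \<open>A\<close>.\<close>

lemma dim_orthogonal_to_set:
  fixes A :: "'v::euclidean_space set"
  shows "dim {u. \<forall>a\<in>A. a \<bullet> u = 0} + dim A = DIM('v)"
proof -
  have "(\<forall>a\<in>A. a \<bullet> u = 0) \<longleftrightarrow> (\<forall>a\<in>span A. orthogonal a u)" for u
  proof
    assume "\<forall>a\<in>A. a \<bullet> u = 0"
    then have "orthogonal u a" if "a \<in> A" for a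
      using that by (metis orthogonal_def inner_commute)
    then show "\<forall>a\<in>span A. orthogonal a u"
      using orthogonal_to_span[of _ A u] orthogonal_commute by metis
  next
    assume "\<forall>a\<in>span A. orthogonal a u"
    then show "\<forall>a\<in>A. a \<bullet> u = 0"
      using span_base unfolding orthogonal_def by metis
  qed
  then have "{u. \<forall>a\<in>A. a \<bullet> u = 0} = {u \<in> UNIV. \<forall>a\<in>span A. orthogonal a u}"
    by simp
  moreover have "dim {u \<in> UNIV. \<forall>a\<in>span A. orthogonal a u} + dim (span A) = dim (UNIV :: 'v set)"
    by (rule dim_subspace_orthogonal_to_vectors) simp_all
  ultimately show ?thesis
    by (simp only: dim_span dim_UNIV)
qed

lemma dim_solutions_generic_le:
  fixes \<F> :: "('p::real_normed_vector \<Rightarrow> 'v::euclidean_space) set"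
  assumes "\<forall>f\<in>\<F>. polynomial_function f"
  shows "\<exists>g. real_polynomial_function g \<and> g p\<^sub>0 \<noteq> 0 \<and>
    (\<forall>p. g p \<noteq> 0 \<longrightarrow> dim {u. \<forall>f\<in>\<F>. f p \<bullet> u = 0} \<le> dim {u. \<forall>f\<in>\<F>. f p\<^sub>0 \<bullet> u = 0})"
proof -
  have dims: "dim {u. \<forall>f\<in>\<F>. f p \<bullet> u = 0} + dim ((\<lambda>f. f p) ` \<F>) = DIM('v)" for p
    using dim_orthogonal_to_set[of "(\<lambda>f. f p) ` \<F>"] by simp
  have "dim {u. \<forall>f\<in>\<F>. f p \<bullet> u = 0} \<le> dim {u. \<forall>f\<in>\<F>. f p\<^sub>0 \<bullet> u = 0}"
    if "dim ((\<lambda>f. f p\<^sub>0) ` \<F>) \<le> dim ((\<lambda>f. f p) ` \<F>)" for p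
    using that dims[of p] dims[of p\<^sub>0] by linarith
  with dim_generic_ge[OF assms, of p\<^sub>0] show ?thesis
    by blast
qed

section \<open>Quadratic invariants as the solution space of a linear system\<close>

lemma linear_time_derivative_quad_poly:
  "linear (\<lambda>u :: 'm::{finite,linorder} coeffs. time_derivative (quad_poly u) V x)"
proof -
  have D: "frechet_derivative (quad_poly u) (at x) h =
     (\<Sum>i\<in>UNIV. fst u $ i * (x $ i * h $ i)) +
     (\<Sum>i\<in>UNIV. \<Sum>j\<in>{i<..}. fst (snd u) $ i $ j * (x $ i * h $ j + h $ i * x $ j)) +
     (\<Sum>i\<in>UNIV. snd (snd u) $ i * h $ i)" for u :: "'m coeffs" and h
    by (cases u) (simp add: frechet_derivative_quad_poly mult.assoc)
  have mult: "linear (\<lambda>u. L u * c)" if "linear L" for L :: "'m coeffs \<Rightarrow> real" and c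
    by (rule linearI) (simp_all add: linear_add[OF that] linear_cmul[OF that] distrib_right)
  have coeff: "linear (\<lambda>u :: 'm coeffs. fst u $ i)" "linear (\<lambda>u :: 'm coeffs. fst (snd u) $ i $ j)"
    "linear (\<lambda>u :: 'm coeffs. snd (snd u) $ i)" for i j
    by (auto intro: linearI)
  show ?thesis
    unfolding time_derivative_def D
    by (intro linear_compose_sum linear_compose_add ballI mult coeff)
qed

lemma real_polynomial_function_gyrostat:
  "real_polynomial_function (\<lambda>\<theta> :: real^gparam^'k::finite. gyrostat (\<theta> $ k) y $ l)"
proof -
  have param: "real_polynomial_function (\<lambda>\<theta> :: real^gparam^'k. \<theta> $ k $ s)" for s
    by (intro real_polynomial_function.intros(1) bounded_linear_compose[OF bounded_linear_vec_nth]
        bounded_linear_vec_nth)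
  have "\<forall>l. real_polynomial_function (\<lambda>\<theta> :: real^gparam^'k. gyrostat (\<theta> $ k) y $ l)"
    unfolding forall_3 gyrostat_def vector_3
    by (intro conjI real_polynomial_function_diff real_polynomial_function.intros(2-4) param)
  then show ?thesis
    by simp
qed

lemma real_polynomial_function_time_derivative:
  "real_polynomial_function (\<lambda>\<theta>. time_derivative C (glom_field m \<theta>) x)"
  unfolding time_derivative_def glom_field_def vec_lambda_beta
  by (intro real_polynomial_function_sum real_polynomial_function.intros(2,4)
      real_polynomial_function_gyrostat) simp_all

text \<open>Instead of collecting monomials, the linear system has one equation for each point
  \<open>x\<close>; its solution space is the same.\<close>

lemma num_quadratic_invariants_generic_le:
  fixes m :: "'k::finite \<Rightarrow> 3 \<Rightarrow> 'm::{finite,linorder}"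
  shows "\<exists>g. real_polynomial_function g \<and> g \<theta> \<noteq> 0 \<and>
    (\<forall>\<theta>'. g \<theta>' \<noteq> 0 \<longrightarrow> num_quadratic_invariants m \<theta>' \<le> num_quadratic_invariants m \<theta>)"
proof -
  \<comment> \<open>The vector representing, through the inner product, the linear functional that
    sends the coefficients of \<open>C\<close> to the value of its time derivative at
    \<open>x\<close>.\<close>
  define row :: "(real, 'm) vec \<Rightarrow> real^gparam^'k \<Rightarrow> 'm coeffs" where
    "row x \<theta> = (\<Sum>b\<in>Basis. time_derivative (quad_poly b) (glom_field m \<theta>) x *\<^sub>R b)" for x \<theta>
  \<comment> \<open>Constant equations that cut \<open>coeff_space\<close> out of the space of all
    triples.\<close>
  define E :: "(real^gparam^'k \<Rightarrow> 'm coeffs) set" where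
    "E = (\<lambda>(i, j) _. (0, axis i (axis j 1), 0)) ` {(i, j). \<not> i < j}"
  have row: "row x \<theta> \<bullet> u = time_derivative (quad_poly u) (glom_field m \<theta>) x" for x \<theta> u
  proof -
    have "time_derivative (quad_poly u) (glom_field m \<theta>) x =
        time_derivative (quad_poly (\<Sum>b\<in>Basis. (u \<bullet> b) *\<^sub>R b)) (glom_field m \<theta>) x"
      by (simp add: euclidean_representation)
    also have "\<dots> = (\<Sum>b\<in>Basis. (u \<bullet> b) * time_derivative (quad_poly b) (glom_field m \<theta>) x)"
      by (simp add: linear_sum[OF linear_time_derivative_quad_poly]
          linear_cmul[OF linear_time_derivative_quad_poly])
    finally show ?thesis
      unfolding row_def inner_sum_left by (simp add: inner_commute[of u] mult.commute)
  qed
  have invariants: "quadratic_invariants m \<theta> = {u. \<forall>f\<in>E \<union> range row. f \<theta> \<bullet> u = 0}" for \<theta>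
  proof -
    have "u \<in> coeff_space \<longleftrightarrow> (\<forall>f\<in>E. f \<theta> \<bullet> u = 0)" for u
      by (cases u) (auto simp: coeff_space_def E_def inner_axis')
    then show ?thesis
      by (simp add: quadratic_invariants_def ball_Un row)
  qed
  have "polynomial_function (row x)" for x
    unfolding row_def
    by (intro polynomial_function_sum finite_Basis polynomial_function_mult
        real_polynomial_function_time_derivative[unfolded real_polynomial_function_eq]
        polynomial_function_const)
  then have "\<forall>f\<in>E \<union> range row. polynomial_function f"
    by (simp add: E_def ball_Un case_prod_unfold)
  from dim_solutions_generic_le[OF this, of \<theta>] show ?thesis
    by (simp add: num_quadratic_invariants_def invariants)
qed

section \<open>Density of the generic parameters\<close>

lemma finite_zeros_real_polynomial_function:
  fixes h :: "real \<Rightarrow> real"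
  assumes "real_polynomial_function h" "h t\<^sub>0 \<noteq> 0"
  shows "finite {t. h t = 0}"
proof -
  obtain a n where h: "h = (\<lambda>t. \<Sum>i\<le>n. a i * t ^ i)"
    using assms(1) real_polynomial_function_iff_sum by blast
  then have "\<exists>i\<le>n. a i \<noteq> 0"
    using assms(2) by (auto intro: sum.neutral)
  then show ?thesis
    unfolding h using polyfun_finite_roots by blast
qed

lemma switched_on_subset_closure:
  fixes \<theta> :: "real^gparam^'k::finite"
  assumes g: "real_polynomial_function g" "g \<theta> \<noteq> 0" and "energy_constraint \<theta>"
  shows "switched_on \<theta> S T \<subseteq> closure {\<theta>' \<in> switched_on \<theta> S T. g \<theta>' \<noteq> 0}"
proof
  fix \<theta>'
  assume \<theta>': "\<theta>' \<in> switched_on \<theta> S T"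
  \<comment> \<open>The line with \<open>z 0 = \<theta>\<close> and \<open>z 1 = \<theta>'\<close>.
    At 0 the polynomial \<open>g\<close> is known not to vanish; the approximating points are taken
    near 1, on both sides.\<close>
  define z where "z t = \<theta> + t *\<^sub>R (\<theta>' - \<theta>)" for t :: real
  have lim: "(z \<longlongrightarrow> \<theta>') (at 1)"
    unfolding z_def by (auto intro!: tendsto_eq_intros)
  have "polynomial_function z"
    unfolding z_def
    by (intro polynomial_function_add polynomial_function_const polynomial_function_mult
        polynomial_function_id)
  then have "real_polynomial_function (g \<circ> z)"
    using g(1) by (rule real_polynomial_function_compose)
  moreover have "(g \<circ> z) 0 \<noteq> 0"
    using g(2) by (simp add: z_def)
  ultimately have "finite {t. (g \<circ> z) t = 0}"
    by (rule finite_zeros_real_polynomial_function)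
  \<comment> \<open>A finite set has no limit point, so only \<open>t = 1\<close> itself can be a
    zero close to 1.\<close>
  then have ev_g: "\<forall>\<^sub>F t in at 1. g (z t) \<noteq> 0"
    using islimpt_finite[of "{t. (g \<circ> z) t = 0}" 1] by (simp add: islimpt_iff_eventually)
  have ev_S: "\<forall>\<^sub>F t in at 1. \<forall>k s. (k, s) \<in> S \<union> T \<longrightarrow> z t $ k $ s \<noteq> 0"
  proof (intro eventually_all_finite)
    fix k s
    show "\<forall>\<^sub>F t in at 1. (k, s) \<in> S \<union> T \<longrightarrow> z t $ k $ s \<noteq> 0"
    proof (cases "(k, s) \<in> S \<union> T")
      case True
      then have "\<theta>' $ k $ s \<noteq> 0"
        using \<theta>' unfolding switched_on_def by blast
      moreover have "((\<lambda>t. z t $ k $ s) \<longlongrightarrow> \<theta>' $ k $ s) (at 1)"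
        by (intro tendsto_vec_nth lim)
      ultimately have "\<forall>\<^sub>F t in at 1. z t $ k $ s \<noteq> 0"
        by (intro tendsto_imp_eventually_ne)
      then show ?thesis
        by (rule eventually_mono) simp
    qed auto
  qed
  have energy: "energy_constraint (z t)" for t
    unfolding energy_constraint_def
  proof
    fix k
    \<comment> \<open>The constraint is linear, hence preserved by affine combinations.\<close>
    have "z t $ k $ GP + z t $ k $ GQ + z t $ k $ GR =
        (1 - t) * (\<theta> $ k $ GP + \<theta> $ k $ GQ + \<theta> $ k $ GR)
        + t * (\<theta>' $ k $ GP + \<theta>' $ k $ GQ + \<theta>' $ k $ GR)"
      by (simp add: z_def algebra_simps)
    then show "z t $ k $ GP + z t $ k $ GQ + z t $ k $ GR = 0"
      using \<theta>' assms(3) by (simp add: switched_on_def energy_constraint_def)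
  qed
  have fixed: "z t $ k $ s = \<theta> $ k $ s" if "(k, s) \<notin> S \<union> T" for t k s
    using \<theta>' that by (simp add: switched_on_def z_def)
  have "\<forall>\<^sub>F t in at 1. z t \<in> {\<theta>' \<in> switched_on \<theta> S T. g \<theta>' \<noteq> 0}"
    using ev_g ev_S by eventually_elim (use energy fixed in \<open>auto simp: switched_on_def\<close>)
  then have "\<forall>\<^sub>F t in at 1. z t \<in> closure {\<theta>' \<in> switched_on \<theta> S T. g \<theta>' \<noteq> 0}"
    by (rule eventually_mono) (rule subsetD[OF closure_subset])
  then show "\<theta>' \<in> closure {\<theta>' \<in> switched_on \<theta> S T. g \<theta>' \<noteq> 0}"
    by (rule Lim_in_closed_set[OF closed_closure _ _ lim]) simp
qed

theorem proposition1:
  fixes m :: "'k::finite \<Rightarrow> 3 \<Rightarrow> 'm::{finite,linorder}"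
    and \<theta> :: "real^gparam^'k"
    and S T :: "('k \<times> gparam) set"
  assumes "CARD('m) \<ge> 3"
    and "\<forall>k. inj (m k)"
    and "energy_constraint \<theta>"
    and "S \<subseteq> zero_params \<theta>"
    and "T \<subseteq> compensators \<theta> S"
  shows "generically_on (switched_on \<theta> S T)
           (\<lambda>\<theta>'. num_quadratic_invariants m \<theta>' \<le> num_quadratic_invariants m \<theta>)"
proof -
  \<comment> \<open>One polynomial does both jobs: nonvanishing at \<open>\<theta>\<close> makes its
    zeros nowhere dense among the switched-on parameters, and nonvanishing at
    \<open>\<theta>'\<close> gives the inequality there.\<close>
  obtain g where g: "real_polynomial_function g" "g \<theta> \<noteq> 0"
      "\<And>\<theta>'. g \<theta>' \<noteq> 0 \<Longrightarrow> num_quadratic_invariants m \<theta>' \<le> num_quadratic_invariants m \<theta>"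
    using num_quadratic_invariants_generic_le by blast
  with switched_on_subset_closure[OF g(1,2) assms(3)] show ?thesis
    unfolding generically_on_def by blast
qed

end
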